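(* Let $n \geq 3$ be an integer. There does not exist a bidiophantine $n$-gon, convex or concave, having a side or a diagonal of length equal to $1$.
   Context: Polygons are simple (non-degenerate) polygons in the Euclidean plane $\mathbb{R}^2$, not necessarily convex ("concave" means non-convex). Natural numbers are the positive integers. A polygon is called Diophantine if the distance between every two of its vertices is a natural number. A Diophantine polygon is called bidiophantine if both coordinates of each of its vertices are integers. A diagonal is a segment joining two non-adjacent vertices. *)

theory Defs
  imports "HOL-Analysis.Analysis"
begin

text \<open>
  A polygon is given by the list of its vertices in cyclic order; the vertex with index
  \<open>i\<close> is followed by the one with index \<open>Suc i mod n\<close>, where \<open>n\<close> is the number of vertices.
\<close>

definition next_vertex :: "(real^2) list \<Rightarrow> nat \<Rightarrow> real^2" where
  "next_vertex vs i = vs ! (Suc i mod length vs)"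

text \<open>
  Two different sides may only meet in a common end point. As the vertices are
  distinct, this makes non-adjacent sides disjoint and lets adjacent sides share exactly
  one point, also for triangles. Polygons with all vertices on one line are excluded by
  this condition; an angle of 180 degrees at a vertex is not.
\<close>

definition simple_polygon :: "(real^2) list \<Rightarrow> bool" where
  "simple_polygon vs \<longleftrightarrow>
     length vs \<ge> 3 \<and> distinct vs \<and>
     (\<forall>i<length vs. \<forall>j<length vs. i \<noteq> j \<longrightarrow>
        closed_segment (vs ! i) (next_vertex vs i) \<inter> closed_segment (vs ! j) (next_vertex vs j)
        \<subseteq> {vs ! i, next_vertex vs i} \<inter> {vs ! j, next_vertex vs j})"

definition ngon :: "nat \<Rightarrow> (real^2) list \<Rightarrow> bool" where
  "ngon n vs \<longleftrightarrow> simple_polygon vs \<and> length vs = n"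

definition diophantine :: "(real^2) list \<Rightarrow> bool" where
  "diophantine vs \<longleftrightarrow>
     (\<forall>p\<in>set vs. \<forall>q\<in>set vs. p \<noteq> q \<longrightarrow> (\<exists>k::nat. k \<ge> 1 \<and> dist p q = real k))"

definition bidiophantine :: "(real^2) list \<Rightarrow> bool" where
  "bidiophantine vs \<longleftrightarrow> diophantine vs \<and> (\<forall>p\<in>set vs. \<forall>c. p $ c \<in> \<int>)"

definition adjacent_indices :: "nat \<Rightarrow> nat \<Rightarrow> nat \<Rightarrow> bool" where
  "adjacent_indices n i j \<longleftrightarrow> j = Suc i mod n \<or> i = Suc j mod n"

text \<open>Sides and diagonals are represented by their pairs of end points.\<close>

definition is_side :: "(real^2) list \<Rightarrow> real^2 \<Rightarrow> real^2 \<Rightarrow> bool" where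
  "is_side vs p q \<longleftrightarrow>
     (\<exists>i<length vs. \<exists>j<length vs.
        adjacent_indices (length vs) i j \<and> p = vs ! i \<and> q = vs ! j)"

definition is_diagonal :: "(real^2) list \<Rightarrow> real^2 \<Rightarrow> real^2 \<Rightarrow> bool" where
  "is_diagonal vs p q \<longleftrightarrow>
     (\<exists>i<length vs. \<exists>j<length vs. i \<noteq> j \<and>
        \<not> adjacent_indices (length vs) i j \<and> p = vs ! i \<and> q = vs ! j)"

end

(* Write d = q - p for two vertices at distance 1. For any other vertex r, the identity
   |r - p|^2 - |r - q|^2 = 2 (r - p) . d - 1 shows that the integers |r - p| and |r - q| differ
   in parity, hence by at least 1 = |p - q|: the triangle inequality is an equality and r lies
   on the line pq. But a simple polygon is not contained in a line, since the two sides at an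
   extreme vertex would overlap. *)

theory Submission
  imports Defs
begin

lemma in_closed_segment_on_line:
  fixes u v :: "'a::real_vector"
  assumes "a \<le> b" "b \<le> c"
  shows "u + b *\<^sub>R v \<in> closed_segment (u + a *\<^sub>R v) (u + c *\<^sub>R v)"
proof -
  have "b \<in> closed_segment a c"
    using assms by (simp add: closed_segment_eq_real_ivl)
  then obtain s where s: "0 \<le> s" "s \<le> 1" "b = (1 - s) * a + s * c"
    by (auto simp: in_segment)
  have "u + b *\<^sub>R v = (1 - s) *\<^sub>R (u + a *\<^sub>R v) + s *\<^sub>R (u + c *\<^sub>R v)"
    by (simp add: s(3) algebra_simps)
  with s(1,2) show ?thesis
    by (auto simp: in_segment)
qed

text \<open>On a line, take a vertex \<open>vs ! m\<close> that is extreme in one direction. Both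
  neighbours lie on the same side of it, so the nearer one lies on the polygon side leading to the
  farther one, where simplicity forbids it.\<close>

lemma simple_polygon_not_collinear:
  assumes "simple_polygon vs"
  shows "\<not> collinear (set vs)"
proof
  assume "collinear (set vs)"
  then obtain u v where "\<forall>x\<in>set vs. \<exists>c. x = u + c *\<^sub>R v"
    unfolding collinear_alt by blast
  then obtain t where t: "\<And>x. x \<in> set vs \<Longrightarrow> x = u + t x *\<^sub>R v"
    by metis
  define n where "n = length vs"
  have n: "n \<ge> 3" and dist: "distinct vs"
    and disj: "\<And>i j. i < n \<Longrightarrow> j < n \<Longrightarrow> i \<noteq> j \<Longrightarrow>
      closed_segment (vs ! i) (next_vertex vs i) \<inter> closed_segment (vs ! j) (next_vertex vs j)
        \<subseteq> {vs ! i, next_vertex vs i} \<inter> {vs ! j, next_vertex vs j}"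
    using assms unfolding simple_polygon_def n_def by blast+
  define m where "m = arg_min_on (\<lambda>i. t (vs ! i)) {..<n}"
  have ne: "{..<n} \<noteq> {}" using n by (auto simp: lessThan_empty_iff)
  have m: "m < n"
    using arg_min_if_finite(1)[OF _ ne] by (auto simp: m_def)
  have min: "t (vs ! m) \<le> t (vs ! i)" if "i < n" for i
    using arg_min_least[OF _ ne, of i] that by (auto simp: m_def)
  define k where "k = Suc m mod n"
  \<comment> \<open>The cyclic predecessor of \<open>m\<close>; the case split is needed because
    subtraction on \<open>nat\<close> truncates at 0.\<close>
  define j where "j = (if m = 0 then n - 1 else m - 1)"
  have k: "k < n" using n by (simp add: k_def)
  have j: "j < n" using n m by (auto simp: j_def)
  have jm: "Suc j mod n = m" using n m by (auto simp: j_def)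
  \<comment> \<open>\<open>j \<noteq> k\<close> rests on \<open>n \<ge> 3\<close>: with two
    vertices, predecessor and successor would coincide.\<close>
  have neq: "j \<noteq> m" "k \<noteq> m" "j \<noteq> k"
    using n m by (auto simp: j_def k_def mod_Suc split: if_splits)
  have vneq: "vs ! j \<noteq> vs ! m" "vs ! k \<noteq> vs ! m" "vs ! j \<noteq> vs ! k"
    using neq j k m dist by (simp_all add: nth_eq_iff_index_eq n_def)
  have sides: "closed_segment (vs ! m) (vs ! k) \<inter> closed_segment (vs ! m) (vs ! j) \<subseteq> {vs ! m}"
    using disj[OF m j] neq vneq jm
    by (auto simp: next_vertex_def k_def n_def closed_segment_commute)
  have seg: "vs ! b \<in> closed_segment (vs ! m) (vs ! c)"
    if "b < n" "c < n" "t (vs ! b) \<le> t (vs ! c)" for b c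
    using in_closed_segment_on_line[OF min[OF that(1)] that(3), of u v] that(1,2) m
      t[of "vs ! m", symmetric] t[of "vs ! b", symmetric] t[of "vs ! c", symmetric]
    unfolding n_def by (simp only: nth_mem)
  \<comment> \<open>Whichever of \<open>t (vs ! j)\<close> and \<open>t (vs ! k)\<close> is smaller,
    one of the two instances of \<open>seg\<close> puts a neighbour on both sides meeting at
    \<open>vs ! m\<close>.\<close>
  show False
    using seg[OF j k] seg[OF k j] sides vneq by fastforce
qed

text \<open>Parity: equality would make the left side 0, while the right side is an odd
  integer.\<close>

lemma diff_of_squares_odd:
  fixes x y :: nat and m :: int
  assumes "(real x)\<^sup>2 - (real y)\<^sup>2 = 2 * of_int m - 1"
  shows "x \<noteq> y"
proof
  assume "x = y"
  with assms have "of_int (2 * m) = (of_int 1 :: real)" by simp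
  then have "2 * m = 1" by (simp only: of_int_eq_iff)
  then show False by presburger
qed

lemma collinear_if_dist_1:
  fixes p q r :: "real^'n"
  assumes int: "\<And>c. p $ c \<in> \<int>" "\<And>c. q $ c \<in> \<int>" "\<And>c. r $ c \<in> \<int>"
    and pq: "dist p q = 1" and rp: "dist r p = real x" and rq: "dist r q = real y"
  shows "collinear {p, q, r}"
proof -
  \<comment> \<open>The integrality of the coordinates enters here.\<close>
  have "(r - p) \<bullet> (q - p) \<in> \<int>"
    unfolding inner_vec_def by (auto intro!: Ints_sum Ints_mult Ints_diff int)
  then obtain m where m: "(r - p) \<bullet> (q - p) = of_int m"
    by (auto elim: Ints_cases)
  have "(norm (r - p))\<^sup>2 - (norm (r - q))\<^sup>2 = 2 * ((r - p) \<bullet> (q - p)) - (norm (q - p))\<^sup>2"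
    by (simp add: power2_norm_eq_inner inner_diff inner_commute algebra_simps)
  then have "(real x)\<^sup>2 - (real y)\<^sup>2 = 2 * of_int m - 1"
    using m pq rp rq by (simp add: dist_norm norm_minus_commute)
  then have "x \<noteq> y" by (rule diff_of_squares_odd)
  moreover have "real x \<le> real y + 1" "real y \<le> real x + 1"
    using dist_triangle[of r p q] dist_triangle[of r q p] pq rp rq by (auto simp: dist_commute)
  ultimately consider "real x = real y + 1" | "real y = real x + 1" by linarith
  \<comment> \<open>Since \<open>dist p q = 1\<close>, each case is an equality in the triangle
    inequality, which places \<open>q\<close> or \<open>p\<close> between the other two
    points.\<close>
  then have "between (r, p) q \<or> between (r, q) p"
    using pq rp rq by cases (simp_all add: between dist_commute)
  then show ?thesis
    unfolding collinear_between_cases by (auto simp: between_commute)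
qed

theorem mainTheorem1:
  fixes n :: nat
  assumes "n \<ge> 3"
  shows "\<not> (\<exists>vs :: (real^2) list. ngon n vs \<and> bidiophantine vs \<and>
              (\<exists>p q. (is_side vs p q \<or> is_diagonal vs p q) \<and> dist p q = 1))"
proof
  assume "\<exists>vs :: (real^2) list. ngon n vs \<and> bidiophantine vs \<and>
              (\<exists>p q. (is_side vs p q \<or> is_diagonal vs p q) \<and> dist p q = 1)"
  then obtain vs :: "(real^2) list" and p q where
    vs: "simple_polygon vs" "bidiophantine vs"
    and "is_side vs p q \<or> is_diagonal vs p q" and pq: "dist p q = 1"
    unfolding ngon_def by blast
  then have p: "p \<in> set vs" and q: "q \<in> set vs"
    unfolding is_side_def is_diagonal_def by auto
  \<comment> \<open>Allowing distance 0 lets \<open>r\<close> below range over all vertices,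
    \<open>p\<close> and \<open>q\<close> included.\<close>
  have nat_dist: "\<exists>k::nat. dist a b = real k" if "a \<in> set vs" "b \<in> set vs" for a b
  proof (cases "a = b")
    case True
    then show ?thesis by (intro exI[of _ 0]) simp
  next
    case False
    then show ?thesis using vs(2) that unfolding bidiophantine_def diophantine_def by blast
  qed
  have "collinear {p, q, r}" if r: "r \<in> set vs" for r
  proof -
    obtain x y :: nat where "dist r p = real x" "dist r q = real y"
      using nat_dist r p q by metis
    then show ?thesis
      using vs(2) p q r pq unfolding bidiophantine_def by (intro collinear_if_dist_1) auto
  qed
  moreover have "p \<noteq> q" using pq by auto
  ultimately have "collinear (set vs)"
    using collinear_triples[of p q "set vs"] p q by (simp add: insert_absorb)
  then show False
    using simple_polygon_not_collinear[OF vs(1)] by blast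
qed

end
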